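(* Let $G$ be a proper simple game with $n$ players. If $G$ has a winning coalition consisting of two players, then $G$ is roughly weighted.
   Context: A simple game is $(P,W)$ with $P=[n]$, $W\subseteq 2^P$ (winning coalitions) closed under supersets within $P$, $W\ne\emptyset$, $W\ne 2^P$; other coalitions are losing. It is proper if $X\in W$ implies $P\setminus X\notin W$. It is roughly weighted if there exist non-negative reals $w_1,\dots,w_n$ and a real $q$, not all zero, such that $\sum_{i\in X}w_i<q$ implies $X$ losing and $\sum_{i\in X}w_i>q$ implies $X$ winning. *)

theory Defs
  imports Complex_Main
begin

text \<open>
  A game on the players \<open>{1..n}\<close> is given by its set \<open>W\<close> of winning coalitions; the
  losing coalitions are the subsets of \<open>{1..n}\<close> that are not in \<open>W\<close>.
\<close>

definition simple_game :: "nat \<Rightarrow> nat set set \<Rightarrow> bool" where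
  "simple_game n W \<longleftrightarrow>
     W \<subseteq> Pow {1..n} \<and>
     (\<forall>X Y. X \<in> W \<longrightarrow> X \<subseteq> Y \<longrightarrow> Y \<subseteq> {1..n} \<longrightarrow> Y \<in> W) \<and>
     W \<noteq> {} \<and> W \<noteq> Pow {1..n}"

definition proper_game :: "nat \<Rightarrow> nat set set \<Rightarrow> bool" where
  "proper_game n W \<longleftrightarrow> (\<forall>X\<in>W. {1..n} - X \<notin> W)"

text \<open>
  The condition ``not all zero'' concerns the \<open>n + 1\<close> numbers \<open>w 1, \<dots>, w n, q\<close>;
  values of \<open>w\<close> outside \<open>{1..n}\<close> play no role.
\<close>

definition roughly_weighted :: "nat \<Rightarrow> nat set set \<Rightarrow> bool" where
  "roughly_weighted n W \<longleftrightarrow>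
     (\<exists>(w :: nat \<Rightarrow> real) (q :: real).
        (\<forall>i\<in>{1..n}. 0 \<le> w i) \<and>
        ((\<exists>i\<in>{1..n}. w i \<noteq> 0) \<or> q \<noteq> 0) \<and>
        (\<forall>X. X \<subseteq> {1..n} \<longrightarrow>
           ((\<Sum>i\<in>X. w i) < q \<longrightarrow> X \<notin> W) \<and>
           ((\<Sum>i\<in>X. w i) > q \<longrightarrow> X \<in> W)))"

end

theory Submission
  imports Defs
begin

text \<open>
  If \<open>{a, b}\<close> is winning then, by properness, every winning coalition meets \<open>{a, b}\<close>.
  Hence weight 1 on \<open>a\<close> and \<open>b\<close>, weight 0 elsewhere and threshold 1 work: a
  coalition of weight below 1 avoids \<open>{a, b}\<close>, one of weight above 1 contains it.
\<close>

theorem theorem15: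
  fixes n :: nat and W :: "nat set set"
  assumes "simple_game n W"
    and "proper_game n W"
    and "\<exists>X\<in>W. card X = 2"
  shows "roughly_weighted n W"
proof -
  obtain A where A: "A \<in> W" "card A = 2" using assms(3) by blast
  have sub: "W \<subseteq> Pow {1..n}"
    and up: "\<And>X Y. X \<in> W \<Longrightarrow> X \<subseteq> Y \<Longrightarrow> Y \<subseteq> {1..n} \<Longrightarrow> Y \<in> W"
    using assms(1) unfolding simple_game_def by blast+
  have finA: "finite A" using A(2) by (simp add: card_ge_0_finite)
  define w :: "nat \<Rightarrow> real" where "w = (\<lambda>i. if i \<in> A then 1 else 0)"
  have weight: "(\<Sum>i\<in>X. w i) = real (card (X \<inter> A))" if "X \<subseteq> {1..n}" for X
    using finite_subset[OF that] by (simp add: w_def sum.If_cases)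
  have lose: "X \<notin> W" if X: "X \<subseteq> {1..n}" "(\<Sum>i\<in>X. w i) < 1" for X
  proof
    assume "X \<in> W"
    then have "{1..n} - X \<notin> W" using assms(2) unfolding proper_game_def by blast
    \<comment> \<open>The weight is a cardinality, so below 1 it is 0; \<open>finA\<close> rules out
      the value 0 that \<open>card\<close> takes on infinite sets.\<close>
    moreover have "X \<inter> A = {}" using X weight finA by simp
    then have "A \<subseteq> {1..n} - X" using A sub by blast
    ultimately show False using up[OF A(1)] by blast
  qed
  have win: "X \<in> W" if X: "X \<subseteq> {1..n}" "1 < (\<Sum>i\<in>X. w i)" for X
  proof -
    \<comment> \<open>By integrality, a weight above 1 is at least 2, the size of
      \<open>A\<close>.\<close>
    have "card A \<le> card (X \<inter> A)" using X weight A(2) by simp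
    then have "X \<inter> A = A" using card_seteq[OF finA] by blast
    then show ?thesis using up[OF A(1)] X(1) by blast
  qed
  show ?thesis
    unfolding roughly_weighted_def
    \<comment> \<open>The threshold 1 is itself nonzero, which settles the requirement that not all
      numbers vanish.\<close>
    by (rule exI[of _ w], rule exI[of _ 1]) (use lose win in \<open>auto simp: w_def\<close>)
qed

end
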